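(* Let $k\ge 1$ and $t\ge 1$ be integers, and let $Q$ be a nonempty finite poset. Then $\mathrm{R}^{\sharp}_{k,t}(\mathcal B\mid Q)<\infty$; that is, there exists a positive integer $N$ such that every $k$-coloring of the $t$-chains of $B_N$ contains a monochromatic induced copy of $Q$.
   Context: $B_n=2^{[n]}$ denotes the Boolean lattice of all subsets of $[n]$ ordered by inclusion, and $\mathcal B=\{B_n:n\ge1\}$. A $t$-chain in a poset is a set of $t$ distinct pairwise comparable elements. A $k$-coloring of the $t$-chains of a poset is a function assigning one of $k$ colors to each $t$-chain. An induced copy of $Q$ in a poset $R$ is the image $f(Q)$ of an injection $f:Q\to R$ such that $x\le y$ in $Q$ if and only if $f(x)\le f(y)$ in $R$. An induced copy is monochromatic if all $t$-chains contained in it have the same color. The strong Boolean Ramsey number $\mathrm{R}^{\sharp}_{k,t}(\mathcal B\mid Q)$ is the smallest $N$ such that every $k$-coloring of the $t$-chains of $B_N$ contains a monochromatic induced copy of $Q$ (and is $\infty$ if no such $N$ exists). *)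

theory Defs
  imports Main "HOL-Library.FuncSet" "HOL-Library.Extended_Nat"
begin

text \<open>A poset is given by its ground set together with its (reflexive) order relation.\<close>

definition boolean_lattice :: "nat \<Rightarrow> nat set set" where
  "boolean_lattice n = Pow {1..n}"

definition boolean_order :: "nat \<Rightarrow> nat set rel" where
  "boolean_order n = relation_of (\<subseteq>) (boolean_lattice n)"

definition t_chains :: "nat \<Rightarrow> 'a set \<Rightarrow> 'a rel \<Rightarrow> 'a set set" where
  "t_chains t P r = {C \<in> Chains r. C \<subseteq> P \<and> finite C \<and> card C = t}"

text \<open>The colors are the numbers below \<^term>\<open>k\<close>.  A coloring is a function on the whole type
  of sets, but its values outside the set of \<^term>\<open>t\<close>-chains are unconstrained and never used.\<close>

definition chain_coloring ::
    "nat \<Rightarrow> nat \<Rightarrow> 'a set \<Rightarrow> 'a rel \<Rightarrow> ('a set \<Rightarrow> nat) \<Rightarrow> bool" where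
  "chain_coloring k t P r c \<longleftrightarrow> c \<in> t_chains t P r \<rightarrow> {..<k}"

definition induced_copy :: "'q set \<Rightarrow> 'q rel \<Rightarrow> 'a set \<Rightarrow> 'a rel \<Rightarrow> 'a set \<Rightarrow> bool" where
  "induced_copy Q s P r S \<longleftrightarrow>
     (\<exists>f. f \<in> Q \<rightarrow> P \<and> inj_on f Q \<and>
          (\<forall>x\<in>Q. \<forall>y\<in>Q. (x, y) \<in> s \<longleftrightarrow> (f x, f y) \<in> r) \<and> S = f ` Q)"

definition monochromatic ::
    "nat \<Rightarrow> 'a set \<Rightarrow> 'a rel \<Rightarrow> ('a set \<Rightarrow> nat) \<Rightarrow> 'a set \<Rightarrow> bool" where
  "monochromatic t P r c S \<longleftrightarrow>
     (\<forall>C\<in>t_chains t P r. \<forall>D\<in>t_chains t P r. C \<subseteq> S \<longrightarrow> D \<subseteq> S \<longrightarrow> c C = c D)"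

definition boolean_arrows :: "nat \<Rightarrow> nat \<Rightarrow> 'q set \<Rightarrow> 'q rel \<Rightarrow> nat \<Rightarrow> bool" where
  "boolean_arrows k t Q s N \<longleftrightarrow>
     (\<forall>c. chain_coloring k t (boolean_lattice N) (boolean_order N) c \<longrightarrow>
        (\<exists>S. induced_copy Q s (boolean_lattice N) (boolean_order N) S \<and>
             monochromatic t (boolean_lattice N) (boolean_order N) c S))"

text \<open>The infimum in \<^typ>\<open>enat\<close> is the least element of the set, and \<^term>\<open>\<infinity> :: enat\<close> if
  the set is empty.\<close>

definition strong_boolean_ramsey :: "nat \<Rightarrow> nat \<Rightarrow> 'q set \<Rightarrow> 'q rel \<Rightarrow> enat" where
  "strong_boolean_ramsey k t Q s = Inf (enat ` {N. N \<ge> 1 \<and> boolean_arrows k t Q s N})"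

end

theory Submission
  imports Defs "HOL-Library.Ramsey"
begin

text \<open>
  A \<open>t\<close>-chain in a Boolean lattice can have many shapes, and for a copy that contains chains of
  two different shapes a coloring by shape defeats monochromaticity.  The way out is a copy
  of \<open>Q\<close> all of whose \<open>t\<close>-chains have the same shape.  Such copies live in grids: if \<open>Q\<close> is placed
  in \<open>{..<m}\<^sup>d\<close> so that \<open>x < y\<close> in \<open>Q\<close> makes \<^emph>\<open>every\<close> coordinate strictly larger, then a
  \<open>t\<close>-chain of the copy is described by \<open>d\<close> many \<open>t\<close>-subsets, one for each axis, matched in
  increasing order.

  Every finite poset has such a placement (\<open>strict_realizer\<close>), with \<open>d\<close> and \<open>m\<close> depending on its
  size only.  A coloring of the \<open>t\<close>-chains of a large grid induces a coloring of \<open>d\<close>-tuples of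
  \<open>t\<close>-subsets, and the product form of Ramsey's theorem (\<open>product_ramsey\<close>) yields an \<open>m\<close>-subset of
  each axis on which this coloring is constant.  Placing \<open>Q\<close> on the subgrid spanned by these sets
  gives a monochromatic copy.  Finally a grid with \<open>d\<close> axes and values up to \<open>M\<close> is an induced
  subposet of the Boolean lattice of dimension \<open>d * M\<close>: a tuple of numbers is encoded by a union of
  \<open>d\<close> initial segments (\<open>staircase_subset_iff\<close>).
\<close>

section \<open>A product form of Ramsey's theorem\<close>

abbreviation nth_least :: "nat set \<Rightarrow> nat \<Rightarrow> nat" where
  "nth_least A j \<equiv> sorted_list_of_set A ! j"

lemma nth_least_in:
  assumes "finite A" "j < card A"
  shows "nth_least A j \<in> A"
  using assms by (metis length_sorted_list_of_set nth_mem set_sorted_list_of_set)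

lemma nth_least_strict_mono:
  assumes "i < j" "j < card A"
  shows "nth_least A i < nth_least A j"
  using assms by (simp add: sorted_wrt_nth_less)

lemma nth_least_image:
  assumes "finite A"
  shows "nth_least A ` {..<card A} = A"
  using assms
  by (metis length_sorted_list_of_set nth_image lessThan_atLeast0 order_refl
      set_sorted_list_of_set take_all_iff)

lemma nth_least_strict_mono_image:
  assumes "strict_mono_on {..<n} a" "j < n"
  shows "nth_least (a ` {..<n}) j = a j"
proof -
  have inj: "inj_on a {..<n}"
    using assms(1) strict_mono_on_imp_inj_on by blast
  have "sorted_wrt (<) (map a [0..<n])"
    using assms(1) by (auto simp: sorted_wrt_iff_nth_less strict_mono_on_def)
  then have "sorted_list_of_set (a ` {..<n}) = map a [0..<n]"
    using sorted_list_of_set_unique[of "a ` {..<n}" "map a [0..<n]"] inj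
    by (simp add: card_image lessThan_atLeast0)
  then show ?thesis
    using assms(2) by simp
qed

text \<open>The \<open>i\<close>-th of the consecutive pieces of length \<open>t\<close> of \<open>B\<close>, listed increasingly.  These pieces
  translate between \<open>d * t\<close>-subsets, to which the usual Ramsey theorem applies, and \<open>d\<close>-tuples of
  \<open>t\<close>-subsets.\<close>

definition block :: "nat \<Rightarrow> nat set \<Rightarrow> nat \<Rightarrow> nat set" where
  "block t B i = (\<lambda>s. nth_least B (i * t + s)) ` {..<t}"

lemma block_index_less:
  fixes i d s t :: nat
  assumes "i < d" "s < t"
  shows "i * t + s < d * t"
proof -
  have "i * t + s < Suc i * t"
    using assms(2) by simp
  also have "\<dots> \<le> d * t"
    using assms(1) by (simp only: mult_le_mono1 Suc_leI)
  finally show ?thesis .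
qed

lemma block_in_nsets:
  assumes "finite B" "card B = d * t" "i < d"
  shows "block t B i \<in> nsets B t"
proof -
  have "inj_on (\<lambda>s. nth_least B (i * t + s)) {..<t}"
  proof (rule strict_mono_on_imp_inj_on, rule strict_mono_onI)
    fix s s' assume "s \<in> {..<t}" "s' \<in> {..<t}" "s < s'"
    then show "nth_least B (i * t + s) < nth_least B (i * t + s')"
      using block_index_less[of i d s' t] assms by (intro nth_least_strict_mono) auto
  qed
  then have "card (block t B i) = t"
    by (simp add: block_def card_image)
  moreover have "block t B i \<subseteq> B"
    using assms by (auto simp: block_def intro!: nth_least_in block_index_less)
  ultimately show ?thesis
    by (simp add: nsets_def block_def)
qed

lemma block_less:
  assumes "card B = d * t" "i < i'" "i' < d" "a \<in> block t B i" "a' \<in> block t B i'"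
  shows "a < a'"
proof -
  obtain s s' where s: "s < t" "s' < t"
    and a: "a = nth_least B (i * t + s)" "a' = nth_least B (i' * t + s')"
    using assms(4,5) by (auto simp: block_def)
  have "i * t + s < i' * t + s'"
    using block_index_less[OF assms(2) s(1)] by simp
  then show ?thesis
    using a s assms(1,3) by (auto intro!: nth_least_strict_mono block_index_less)
qed

text \<open>Cutting into blocks inverts taking unions, provided the given sets follow one another: then
  listing the sets one after the other lists their union increasingly.\<close>

lemma block_Union:
  assumes A: "\<And>i. i < d \<Longrightarrow> finite (A i) \<and> card (A i) = t"
    and less: "\<And>i i' a a'. i < i' \<Longrightarrow> i' < d \<Longrightarrow> a \<in> A i \<Longrightarrow> a' \<in> A i' \<Longrightarrow> a < a'"
  shows "card (\<Union>i<d. A i) = d * t" "i < d \<Longrightarrow> block t (\<Union>i<d. A i) i = A i"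
proof -
  \<comment> \<open>the concatenation of the increasing lists of the \<open>A i\<close>\<close>
  define a where "a q = nth_least (A (q div t)) (q mod t)" for q
  have div: "q div t < d" "q mod t < t" if "q < d * t" for q
    using that by (simp_all add: less_mult_imp_div_less)
      (metis mod_less_divisor mult_0_right not_gr_zero not_less_zero)
  have mono: "strict_mono_on {..<d * t} a"
  proof (rule strict_mono_onI)
    fix p q assume pq: "p \<in> {..<d * t}" "q \<in> {..<d * t}" and "p < q"
    then have p: "p div t < d" "p mod t < t" and q: "q div t < d" "q mod t < t"
      using div by simp_all
    consider "p div t < q div t" | "p div t = q div t" "p mod t < q mod t"
    proof (cases "p div t = q div t")
      case True
      then have "p mod t < q mod t"
        using \<open>p < q\<close> div_mult_mod_eq[of p t] div_mult_mod_eq[of q t] by (metis nat_add_left_cancel_less)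
      then show ?thesis
        using that(2) True by blast
    next
      case False
      then show ?thesis
        using that(1) div_le_mono[of p q t] \<open>p < q\<close> by linarith
    qed
    then show "a p < a q"
    proof cases
      case 1
      then show ?thesis
        using pq p q A unfolding a_def
        by (intro less[OF 1 q(1), of "nth_least _ _" "nth_least _ _"] nth_least_in) simp_all
    next
      case 2
      then show ?thesis
        using pq q A unfolding a_def by (simp add: nth_least_strict_mono)
    qed
  qed
  have a_block: "(\<lambda>s. a (i * t + s)) ` {..<t} = A i" if "i < d" for i
  proof -
    have "(\<lambda>s. a (i * t + s)) ` {..<t} = nth_least (A i) ` {..<t}"
      by (rule image_cong) (auto simp: a_def)
    then show ?thesis
      using nth_least_image A that by metis
  qed
  have img: "a ` {..<d * t} = (\<Union>i<d. A i)"
  proof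
    show "a ` {..<d * t} \<subseteq> (\<Union>i<d. A i)"
      using div A by (fastforce simp: a_def intro: nth_least_in)
    show "(\<Union>i<d. A i) \<subseteq> a ` {..<d * t}"
      using a_block block_index_less by (fastforce simp flip: a_block)
  qed
  show "card (\<Union>i<d. A i) = d * t"
    using card_image[OF strict_mono_on_imp_inj_on[OF mono]] by (simp add: img)
  show "block t (\<Union>i<d. A i) i = A i" if "i < d"
  proof -
    have "block t (\<Union>i<d. A i) i = (\<lambda>s. a (i * t + s)) ` {..<t}"
      unfolding block_def img[symmetric]
      by (rule image_cong) (auto intro!: nth_least_strict_mono_image mono block_index_less that)
    then show ?thesis
      using a_block that by simp
  qed
qed

text \<open>Nothing prevents the sets \<open>S i\<close> from following one another in a common interval.  Color a \<open>d * t\<close>-subset by the tuple of its blocks.  A homogeneous set of size \<open>d * m\<close> is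
  itself cut into \<open>d\<close> blocks of size \<open>m\<close>, and \<open>t\<close>-subsets chosen from these are the blocks of
  their union, so a single application of Ramsey's theorem suffices.\<close>

theorem product_ramsey:
  fixes d k m t :: nat
  shows "\<exists>M::nat. \<forall>F \<in> (\<Pi>\<^sub>E i\<in>{..<d}. nsets {..<M} t) \<rightarrow> {..<k}.
    \<exists>S \<in> {..<d} \<rightarrow> nsets {..<M} m. \<exists>col. \<forall>A \<in> (\<Pi>\<^sub>E i\<in>{..<d}. nsets (S i) t). F A = col"
proof -
  obtain M :: nat where M: "partn_lst {..<M} (replicate k (d * m)) (d * t)"
    using ramsey_full by blast
  show ?thesis
  proof (intro exI[of _ M] ballI)
    fix F assume F: "F \<in> (\<Pi>\<^sub>E i\<in>{..<d}. nsets {..<M} t) \<rightarrow> {..<k}"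
    define G where "G B = F (\<lambda>i\<in>{..<d}. block t B i)" for B
    have "G \<in> nsets {..<M} (d * t) \<rightarrow> {..<k}"
    proof
      fix B assume B: "B \<in> nsets {..<M} (d * t)"
      then have "block t B i \<in> nsets {..<M} t" if "i < d" for i
        using block_in_nsets[of B d t i] that by (auto simp: nsets_def)
      then have "(\<lambda>i\<in>{..<d}. block t B i) \<in> (\<Pi>\<^sub>E i\<in>{..<d}. nsets {..<M} t)"
        by auto
      then show "G B \<in> {..<k}"
        unfolding G_def using F by blast
    qed
    then obtain col H where "col < k" and H: "H \<in> nsets {..<M} (d * m)"
      and G: "G ` nsets H (d * t) \<subseteq> {col}"
      using M by (fastforce simp: partn_lst_def Ramsey.monochromatic_def)
    have finH: "finite H" "card H = d * m" "H \<subseteq> {..<M}"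
      using H by (auto simp: nsets_def)
    have S: "block m H i \<in> nsets H m" if "i < d" for i
      using block_in_nsets finH that by blast
    have "F A = col" if A: "A \<in> (\<Pi>\<^sub>E i\<in>{..<d}. nsets (block m H i) t)" for A
    proof -
      have Ai: "A i \<subseteq> block m H i" "finite (A i)" "card (A i) = t" if "i < d" for i
        using A that by (auto simp: PiE_iff nsets_def)
      have less: "a < a'" if "i < i'" "i' < d" "a \<in> A i" "a' \<in> A i'" for i i' a a'
        using block_less[OF finH(2) that(1,2)] Ai that by (meson order.strict_trans subsetD)
      let ?B = "\<Union>i<d. A i"
      have bl: "block t ?B i = A i" if "i < d" for i
        using block_Union(2)[of d A t i] Ai less that by blast
      have "card ?B = d * t"
        using block_Union(1)[of d A t] Ai less by blast
      moreover have "?B \<subseteq> H"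
        using Ai(1) S by (fastforce simp: nsets_def)
      ultimately have "?B \<in> nsets H (d * t)"
        using finH by (auto simp: nsets_def intro: finite_subset)
      then have "G ?B = col"
        using G by blast
      moreover have "(\<lambda>i\<in>{..<d}. block t ?B i) = A"
        using A bl by (intro ext) (auto simp: restrict_def PiE_iff extensional_def)
      ultimately show ?thesis
        by (simp add: G_def)
    qed
    moreover have "block m H \<in> {..<d} \<rightarrow> nsets {..<M} m"
      using S finH(3) nsets_mono by fastforce
    ultimately show "\<exists>S \<in> {..<d} \<rightarrow> nsets {..<M} m.
        \<exists>col. \<forall>A \<in> (\<Pi>\<^sub>E i\<in>{..<d}. nsets (S i) t). F A = col"
      by blast
  qed
qed

section \<open>Embedding a finite poset in a grid\<close>

text \<open>One coordinate for each element of \<open>Q\<close>.  The size of the principal down-set is strictly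
  monotone; the coordinate of \<open>e\<close> raises it by \<open>card Q\<close> outside the down-set of \<open>e\<close>, which keeps it
  strictly monotone and puts every \<open>x\<close> that is not below \<open>e\<close> above \<open>e\<close>.  Hence the coordinates
  together reflect the order.\<close>

lemma strict_realizer:
  assumes "finite Q" "partial_order_on Q s"
  obtains L :: "nat \<Rightarrow> 'q \<Rightarrow> nat"
  where "\<And>i x. x \<in> Q \<Longrightarrow> L i x \<le> 2 * card Q"
    and "\<And>i x y. (x, y) \<in> s \<Longrightarrow> x \<noteq> y \<Longrightarrow> L i x < L i y"
    and "\<And>x y. x \<in> Q \<Longrightarrow> y \<in> Q \<Longrightarrow> (\<And>i. i < card Q \<Longrightarrow> L i x \<le> L i y) \<Longrightarrow> (x, y) \<in> s"
proof -
  have refl: "(x, x) \<in> s" if "x \<in> Q" for x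
    using assms(2) that by (auto simp: partial_order_on_def preorder_on_def refl_on_def)
  have trans: "(x, z) \<in> s" if "(x, y) \<in> s" "(y, z) \<in> s" for x y z
    using assms(2) that by (meson partial_order_on_def preorder_on_def transD)
  have antisym: "x = y" if "(x, y) \<in> s" "(y, x) \<in> s" for x y
    using assms(2) that by (meson partial_order_on_def antisymD)
  have field: "x \<in> Q \<and> y \<in> Q" if "(x, y) \<in> s" for x y
    using assms(2) that by (auto simp: partial_order_on_def preorder_on_def refl_on_def)
  obtain e where e: "bij_betw e {..<card Q} Q"
    using ex_bij_betw_nat_finite[OF assms(1)] lessThan_atLeast0 by metis
  define D where "D x = {z \<in> Q. (z, x) \<in> s}" for x
  define L where "L i x = card (D x) + (if (x, e i) \<in> s then 0 else card Q)" for i x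
  have D_le: "card (D x) \<le> card Q" for x
    unfolding D_def by (rule card_mono) (use assms(1) in auto)
  show thesis
  proof
    show "L i x \<le> 2 * card Q" for i x
      using D_le[of x] by (simp add: L_def)
  next
    fix i x y assume xy: "(x, y) \<in> s" "x \<noteq> y"
    then have "D x \<subset> D y"
      unfolding D_def using refl trans antisym field by blast
    then have "card (D x) < card (D y)"
      by (intro psubset_card_mono) (auto simp: D_def assms(1))
    then show "L i x < L i y"
      using trans[OF xy(1)] by (auto simp: L_def)
  next
    fix x y assume xy: "x \<in> Q" "y \<in> Q" and le: "\<And>i. i < card Q \<Longrightarrow> L i x \<le> L i y"
    obtain i where i: "i < card Q" "e i = y"
      using e xy(2) by (metis bij_betw_imp_surj_on imageE lessThan_iff)
    have "card (D x) > 0"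
      using xy(1) refl assms(1) by (auto simp: card_gt_0_iff D_def)
    then show "(x, y) \<in> s"
      using le[OF i(1)] refl[OF xy(2)] D_le[of y] i(2) by (auto simp: L_def split: if_splits)
  qed
qed

section \<open>Embedding a grid in a Boolean lattice\<close>

text \<open>The integers from \<open>1\<close> to \<open>d * M\<close> form \<open>d\<close> segments of length \<open>M\<close>; the set takes the first
  \<open>h i\<close> elements of segment \<open>i\<close>.\<close>

definition staircase :: "nat \<Rightarrow> nat \<Rightarrow> (nat \<Rightarrow> nat) \<Rightarrow> nat set" where
  "staircase M d h = {Suc (i * M + j) | i j. i < d \<and> j < h i}"

lemma staircase_in_boolean_lattice:
  assumes "\<And>i. i < d \<Longrightarrow> h i \<le> M"
  shows "staircase M d h \<in> boolean_lattice (d * M)"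
proof -
  have "i * M + j < d * M" if "i < d" "j < h i" for i j
    using assms[OF that(1)] that by (intro block_index_less) auto
  then show ?thesis
    by (auto simp: staircase_def boolean_lattice_def Suc_le_eq)
qed

lemma staircase_subset_iff:
  assumes "\<And>i. i < d \<Longrightarrow> h i \<le> M" "\<And>i. i < d \<Longrightarrow> h' i \<le> M"
  shows "staircase M d h \<subseteq> staircase M d h' \<longleftrightarrow> (\<forall>i<d. h i \<le> h' i)"
proof
  assume sub: "staircase M d h \<subseteq> staircase M d h'"
  show "\<forall>i<d. h i \<le> h' i"
  proof (intro allI impI, rule ccontr)
    fix i assume i: "i < d" "\<not> h i \<le> h' i"
    then have "Suc (i * M + h' i) \<in> staircase M d h"
      unfolding staircase_def by (intro CollectI exI[of _ i] exI[of _ "h' i"]) simp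
    then have "Suc (i * M + h' i) \<in> staircase M d h'"
      using sub by blast
    then obtain i' j where j: "i' < d" "j < h' i'" "i * M + h' i = i' * M + j"
      unfolding staircase_def mem_Collect_eq nat.inject by blast
    have "h' i < M" "j < M"
      using i assms[of i] assms(2)[OF j(1)] j(2) by auto
    then have "(i * M + h' i) div M = i" "(i' * M + j) div M = i'"
      by simp_all
    then have "i = i' \<and> h' i = j"
      using j(3) by simp
    then show False
      using j(2) by (metis less_irrefl)
  qed
next
  assume "\<forall>i<d. h i \<le> h' i"
  then show "staircase M d h \<subseteq> staircase M d h'"
    unfolding staircase_def by (blast intro: order.strict_trans2)
qed

text \<open>At least one axis is needed: otherwise all tuples coincide and the set of staircases has fewer
  than \<open>t\<close> elements as soon as \<open>t > 1\<close>.\<close>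

lemma staircase_chain:
  assumes "d > 0" and le: "\<And>i r. i < d \<Longrightarrow> r < t \<Longrightarrow> u i r \<le> M"
    and mono: "\<And>i. i < d \<Longrightarrow> strict_mono_on {..<t} (u i)"
  shows "(\<lambda>r. staircase M d (\<lambda>i. u i r)) ` {..<t}
    \<in> t_chains t (boolean_lattice (d * M)) (boolean_order (d * M))" (is "?c ` _ \<in> _")
proof -
  have iff: "?c r \<subseteq> ?c r' \<longleftrightarrow> (\<forall>i<d. u i r \<le> u i r')" if "r < t" "r' < t" for r r'
    using that le by (intro staircase_subset_iff) auto
  have c_le: "?c r \<subseteq> ?c r' \<longleftrightarrow> r \<le> r'" if "r < t" "r' < t" for r r'
    unfolding iff[OF that] using mono \<open>d > 0\<close> that
    by (metis lessThan_iff strict_mono_on_less_eq)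
  have inB: "?c r \<in> boolean_lattice (d * M)" if "r < t" for r
    using that le by (intro staircase_in_boolean_lattice) auto
  have "inj_on ?c {..<t}"
    by (rule inj_onI) (metis c_le dual_order.refl lessThan_iff order_antisym)
  moreover have "?c ` {..<t} \<in> Chains (boolean_order (d * M))"
    using inB c_le nat_le_linear by (auto simp: Chains_def boolean_order_def relation_of_def)
  ultimately show ?thesis
    using inB by (auto simp: t_chains_def card_image)
qed

section \<open>The Boolean Ramsey theorem for chains\<close>

lemma boolean_arrows_exists:
  fixes Q :: "'q set"
  assumes "finite Q" "Q \<noteq> {}" "partial_order_on Q s"
  obtains N where "N \<ge> 1" "boolean_arrows k t Q s N"
proof -
  define d where "d = card Q"
  define m where "m = Suc (2 * d)"
  have d: "d > 0"
    using assms by (simp add: d_def card_gt_0_iff)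
  obtain L :: "nat \<Rightarrow> 'q \<Rightarrow> nat" where L_le: "\<And>i x. x \<in> Q \<Longrightarrow> L i x < m"
    and L_less: "\<And>i x y. (x, y) \<in> s \<Longrightarrow> x \<noteq> y \<Longrightarrow> L i x < L i y"
    and L_real: "\<And>x y. x \<in> Q \<Longrightarrow> y \<in> Q \<Longrightarrow> (\<And>i. i < d \<Longrightarrow> L i x \<le> L i y) \<Longrightarrow> (x, y) \<in> s"
    using strict_realizer[OF assms(1,3)] unfolding d_def m_def less_Suc_eq_le by metis
  obtain M0 :: nat where M0: "\<forall>F \<in> (\<Pi>\<^sub>E i\<in>{..<d}. nsets {..<M0} t) \<rightarrow> {..<k}.
    \<exists>S \<in> {..<d} \<rightarrow> nsets {..<M0} m. \<exists>col. \<forall>A \<in> (\<Pi>\<^sub>E i\<in>{..<d}. nsets (S i) t). F A = col"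
    using product_ramsey[of d t k m] by (rule exE)
  \<comment> \<open>the successor makes the dimension \<open>d * M\<close> positive even if \<open>M0 = 0\<close>\<close>
  define M where "M = Suc M0"
  let ?P = "boolean_lattice (d * M)" and ?r = "boolean_order (d * M)"
  show thesis
  proof
    show "d * M \<ge> 1"
      using d by (simp add: M_def)
    show "boolean_arrows k t Q s (d * M)"
      unfolding boolean_arrows_def
    proof (intro allI impI)
      fix c assume c: "chain_coloring k t ?P ?r c"
      define F where "F A = c ((\<lambda>r. staircase M d (\<lambda>i. nth_least (A i) r)) ` {..<t})" for A
      have "F \<in> (\<Pi>\<^sub>E i\<in>{..<d}. nsets {..<M0} t) \<rightarrow> {..<k}"
      proof
        fix A assume "A \<in> (\<Pi>\<^sub>E i\<in>{..<d}. nsets {..<M0} t)"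
        then have A: "A i \<subseteq> {..<M0}" "finite (A i)" "card (A i) = t" if "i < d" for i
          using that by (auto simp: PiE_iff nsets_def)
        have "(\<lambda>r. staircase M d (\<lambda>i. nth_least (A i) r)) ` {..<t} \<in> t_chains t ?P ?r"
        proof (rule staircase_chain[OF d])
          fix i r assume "i < d" "r < t"
          then show "nth_least (A i) r \<le> M"
            using nth_least_in[of "A i" r] A by (fastforce simp: M_def)
        next
          fix i assume "i < d"
          then show "strict_mono_on {..<t} (nth_least (A i))"
            using A by (auto intro!: strict_mono_onI nth_least_strict_mono)
        qed
        then show "F A \<in> {..<k}"
          using c unfolding F_def chain_coloring_def by blast
      qed
      from bspec[OF M0 this] obtain S where S0: "S \<in> {..<d} \<rightarrow> nsets {..<M0} m"
        and "\<exists>col. \<forall>A \<in> (\<Pi>\<^sub>E i\<in>{..<d}. nsets (S i) t). F A = col"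
        by (rule bexE)
      from this(2) obtain col :: nat
        where col: "\<forall>A \<in> (\<Pi>\<^sub>E i\<in>{..<d}. nsets (S i) t). F A = col"
        by (rule exE)
      have S: "S i \<subseteq> {..<M0}" "finite (S i)" "card (S i) = m" if "i < d" for i
        using S0 that by (auto simp: nsets_def Pi_iff)
      define p where "p i x = nth_least (S i) (L i x)" for i x
      define f where "f x = staircase M d (\<lambda>i. p i x)" for x
      have p_in: "p i x \<in> S i" if "i < d" "x \<in> Q" for i x
        using that S L_le by (simp add: p_def nth_least_in)
      have p_le_M: "p i x \<le> M" if "i < d" "x \<in> Q" for i x
        using p_in[OF that] S(1)[OF that(1)] by (auto simp: M_def)
      have p_less: "p i x < p i y" if "i < d" "y \<in> Q" "L i x < L i y" for i x y
        using that S L_le by (simp add: p_def nth_least_strict_mono)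
      have f_sub: "f x \<subseteq> f y \<longleftrightarrow> (x, y) \<in> s" if "x \<in> Q" "y \<in> Q" for x y
      proof -
        have "f x \<subseteq> f y \<longleftrightarrow> (\<forall>i<d. p i x \<le> p i y)"
          unfolding f_def using that p_le_M by (intro staircase_subset_iff) auto
        also have "\<dots> \<longleftrightarrow> (x, y) \<in> s"
          using that p_less L_less L_real by (metis leD leI nless_le)
        finally show ?thesis .
      qed
      have f_in: "f x \<in> ?P" if "x \<in> Q" for x
        unfolding f_def using that p_le_M by (intro staircase_in_boolean_lattice) auto
      have inj: "inj_on f Q"
        using f_sub assms(3)
        by (intro inj_onI) (metis antisymD dual_order.refl partial_order_on_def)
      have "induced_copy Q s ?P ?r (f ` Q)"
        unfolding induced_copy_def boolean_order_def relation_of_def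
        using f_in f_sub inj by (intro exI[of _ f]) auto
      moreover have "c C = col" if C: "C \<in> t_chains t ?P ?r" "C \<subseteq> f ` Q" for C
      proof -
        \<comment> \<open>list the preimage of the chain increasingly; coordinate \<open>0\<close> serves as sorting key, since
          any strictly monotone one is injective on a chain\<close>
        define T where "T = {x \<in> Q. f x \<in> C}"
        have fT: "f ` T = C" and TQ: "T \<subseteq> Q"
          using C(2) by (auto simp: T_def)
        have cardT: "card T = t" "finite T"
          using C(1) fT card_image[OF inj_on_subset[OF inj TQ]] finite_subset[OF TQ assms(1)]
          by (auto simp: t_chains_def)
        have comp: "(x, y) \<in> s \<or> (y, x) \<in> s" if "x \<in> T" "y \<in> T" for x y
        proof -
          have "f x \<subseteq> f y \<or> f y \<subseteq> f x"
            using C(1) that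
            by (auto simp: t_chains_def Chains_def boolean_order_def relation_of_def T_def)
          then show ?thesis
            using f_sub that TQ by blast
        qed
        have L_inj: "inj_on (L 0) T"
          by (rule inj_onI) (metis L_less comp less_irrefl)
        obtain h where h: "bij_betw h {..<t} (L 0 ` T)" "strict_mono_on {..<t} h"
          using ex_bij_betw_strict_mono_card[of "L 0 ` T"] cardT card_image[OF L_inj] by auto
        define x where "x r = inv_into T (L 0) (h r)" for r
        have x_bij: "bij_betw x {..<t} T"
          using bij_betw_trans[OF h(1) bij_betw_inv_into[OF inj_on_imp_bij_betw[OF L_inj]]]
          by (simp add: x_def[abs_def] comp_def)
        have xT: "x r \<in> T" if "r < t" for r
          using bij_betwE[OF x_bij] that by blast
        have Lx: "L 0 (x r) = h r" if "r < t" for r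
          using bij_betwE[OF h(1)] that unfolding x_def by (blast intro: f_inv_into_f)
        have x_less: "(x r, x r') \<in> s \<and> x r \<noteq> x r'" if "r < r'" "r' < t" for r r'
        proof -
          have "L 0 (x r) < L 0 (x r')"
            using that h(2) by (simp add: Lx strict_mono_on_def)
          then show ?thesis
            using comp xT that L_less by (metis less_asym less_irrefl order.strict_trans)
        qed
        \<comment> \<open>the tuple of \<open>t\<close>-subsets of the axes that encodes \<open>C\<close>\<close>
        define A where "A = (\<lambda>i\<in>{..<d}. (\<lambda>r. p i (x r)) ` {..<t})"
        have mono: "strict_mono_on {..<t} (\<lambda>r. p i (x r))" if "i < d" for i
          using that x_less xT TQ by (auto intro!: strict_mono_onI p_less L_less)
        have "A \<in> (\<Pi>\<^sub>E i\<in>{..<d}. nsets (S i) t)"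
          using p_in xT TQ card_image[OF strict_mono_on_imp_inj_on[OF mono]]
          by (auto simp: A_def nsets_def)
        moreover have "F A = c C"
        proof -
          have "staircase M d (\<lambda>i. nth_least (A i) r) = f (x r)" if "r < t" for r
            using that nth_least_strict_mono_image[OF mono that]
            by (auto simp: staircase_def f_def A_def)
          then have "(\<lambda>r. staircase M d (\<lambda>i. nth_least (A i) r)) ` {..<t} = f ` x ` {..<t}"
            by (simp add: image_image)
          then show ?thesis
            using x_bij fT by (simp add: F_def bij_betw_def)
        qed
        ultimately show ?thesis
          using bspec[OF col] by simp
      qed
      then have "Defs.monochromatic t ?P ?r c (f ` Q)"
        by (simp add: Defs.monochromatic_def)
      ultimately show "\<exists>S. induced_copy Q s ?P ?r S \<and> Defs.monochromatic t ?P ?r c S"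
        by blast
    qed
  qed
qed

theorem theorem3p5:
  fixes k t :: nat and Q :: "'q set" and s :: "'q rel"
  assumes "k \<ge> 1" and "t \<ge> 1"
    and "finite Q" and "Q \<noteq> {}" and "partial_order_on Q s"
  shows "strong_boolean_ramsey k t Q s < \<infinity> \<and> (\<exists>N\<ge>1. boolean_arrows k t Q s N)"
proof -
  obtain N where N: "N \<ge> 1" "boolean_arrows k t Q s N"
    using boolean_arrows_exists assms(3-5) by blast
  then have "strong_boolean_ramsey k t Q s \<le> enat N"
    unfolding strong_boolean_ramsey_def by (intro Inf_lower) auto
  then have "strong_boolean_ramsey k t Q s < \<infinity>"
    by (rule le_less_trans) simp
  then show ?thesis
    using N by blast
qed

end
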